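(* Let $\mathbf{s}=(s_1,s_2,\ldots,s_d)$ and $\mathbf{t}=(t_1,t_2,\ldots,t_e)$ be sequences of positive integers such that $\mathbf{P}_d^{(\mathbf{s})}$ is Gorenstein of index $k$ and $\mathbf{P}_e^{(\mathbf{t})}$ is Gorenstein of index $\ell$. Then $\mathbf{P}_{d+e+1}^{(\mathbf{s},1,\mathbf{t})}$ is Gorenstein of index $k+\ell$, where $(\mathbf{s},1,\mathbf{t})=(s_1,\ldots,s_d,1,t_1,\ldots,t_e)$.
   Context: For a sequence of positive integers $\mathbf{s}=(s_1,\ldots,s_d)$, the $\mathbf{s}$-lecture hall polytope is $\mathbf{P}_d^{(\mathbf{s})}=\{\mathbf{x}\in\mathbb{R}^d : 0\le \frac{x_1}{s_1}\le\frac{x_2}{s_2}\le\cdots\le\frac{x_d}{s_d}\le 1\}$, a $d$-dimensional lattice polytope. A $d$-dimensional lattice polytope $\mathcal{P}\subset\mathbb{R}^d$ is Fano if $(\mathcal{P}\setminus\partial\mathcal{P})\cap\mathbb{Z}^d=\{\mathbf{0}\}$. It is reflexive if it is Fano and its dual polytope $\mathcal{P}^\vee=\{y\in\mathbb{R}^d : \langle x,y\rangle\le 1 \text{ for all } x\in\mathcal{P}\}$ is a lattice polytope. Two $d$-dimensional lattice polytopes $\mathcal{P},\mathcal{Q}\subset\mathbb{R}^d$ are unimodularly equivalent if $\mathcal{Q}=f_U(\mathcal{P})+\mathbf{w}$ for some $U\in\mathbb{Z}^{d\times d}$ with $\det U=\pm1$ and some $\mathbf{w}\in\mathbb{Z}^d$,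 where $f_U(\mathbf{v})=\mathbf{v}U$. For $c\in\mathbb{Z}_{>0}$, $\mathcal{P}$ is Gorenstein of index $c$ if $c\mathcal{P}=\{c\alpha:\alpha\in\mathcal{P}\}$ is unimodularly equivalent to a reflexive polytope. *)

theory Defs
  imports "HOL-Analysis.Analysis"
begin

text \<open>
  The ambient space of dimension d is \<^typ>\<open>real ^ 'n\<close> with \<^prop>\<open>CARD('n) = d\<close>. The index type carries
  a linear order, and "the first, second, ..., last coordinate" of a vector refers to that order.
\<close>

definition coords :: "real ^ 'n::{finite,linorder} \<Rightarrow> real list" where
  "coords x = map (\<lambda>i. x $ i) (sorted_list_of_set UNIV)"

text \<open>
  The sortedness condition is the chain of inequalities from 0 through the quotients of the
  coordinates by the entries of \<open>s\<close> up to 1. Since \<open>map2\<close> truncates, this is the lecture hall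
  polytope of \<open>s\<close> only when \<^prop>\<open>length s = CARD('n)\<close>.
\<close>

definition lecture_hall :: "nat list \<Rightarrow> (real ^ 'n::{finite,linorder}) set" where
  "lecture_hall s = {x. sorted (0 # map2 (\<lambda>a m. a / real m) (coords x) s @ [1])}"

definition int_points :: "(real ^ 'n) set" where
  "int_points = {x. \<forall>i. x $ i \<in> \<int>}"

definition lattice_polytope :: "(real ^ 'n) set \<Rightarrow> bool" where
  "lattice_polytope P \<longleftrightarrow> (\<exists>V. finite V \<and> V \<subseteq> int_points \<and> P = convex hull V)"

definition full_lattice_polytope :: "(real ^ 'n) set \<Rightarrow> bool" where
  "full_lattice_polytope P \<longleftrightarrow> lattice_polytope P \<and> aff_dim P = int CARD('n)"

definition fano :: "(real ^ 'n) set \<Rightarrow> bool" where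
  "fano P \<longleftrightarrow> full_lattice_polytope P \<and> (P - frontier P) \<inter> int_points = {0}"

definition dual_polytope :: "(real ^ 'n) set \<Rightarrow> (real ^ 'n) set" where
  "dual_polytope P = {y. \<forall>x\<in>P. x \<bullet> y \<le> 1}"

definition reflexive :: "(real ^ 'n) set \<Rightarrow> bool" where
  "reflexive P \<longleftrightarrow> fano P \<and> lattice_polytope (dual_polytope P)"

definition unimodularly_equivalent :: "(real ^ 'n) set \<Rightarrow> (real ^ 'n) set \<Rightarrow> bool" where
  "unimodularly_equivalent P Q \<longleftrightarrow>
     (\<exists>(U :: int ^ 'n ^ 'n) w. det U \<in> {1, - 1} \<and> w \<in> int_points \<and>
        Q = (\<lambda>v. v v* map_matrix real_of_int U + w) ` P)"

definition gorenstein :: "nat \<Rightarrow> (real ^ 'n) set \<Rightarrow> bool" where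
  "gorenstein c P \<longleftrightarrow> c > 0 \<and> full_lattice_polytope P \<and>
     (\<exists>Q. reflexive Q \<and> unimodularly_equivalent ((\<lambda>x. real c *\<^sub>R x) ` P) Q)"

end

theory Submission
  imports Defs
begin

text \<open>
  A dilated lattice simplex is unimodularly equivalent to a reflexive polytope iff it contains a
  lattice point at lattice distance 1 from each of its facets. Put \<open>a = (1, s, 1)\<close>; the facets of
  the \<open>k\<close>-fold dilation of the lecture hall polytope are
  \<open>a\<^sub>i x\<^sub>i\<^sub>+\<^sub>1 - a\<^sub>i\<^sub>+\<^sub>1 x\<^sub>i \<ge> 0\<close>, where \<open>x\<^sub>0 = 0\<close> and \<open>x\<^sub>d\<^sub>+\<^sub>1 = k\<close>. So the polytope is
  Gorenstein of index \<open>k\<close> iff there are integers \<open>W\<^sub>0 = 0, W\<^sub>1, \<dots>, W\<^sub>d\<^sub>+\<^sub>1 = k\<close> with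
  \<open>a\<^sub>i W\<^sub>i\<^sub>+\<^sub>1 - a\<^sub>i\<^sub>+\<^sub>1 W\<^sub>i = gcd(a\<^sub>i, a\<^sub>i\<^sub>+\<^sub>1)\<close>. Adding \<open>k b\<close> to such a sequence for
  \<open>b = (1, t, 1)\<close> preserves all the equations and makes it start with \<open>k\<close>, so that it can be
  appended to a sequence for \<open>s\<close> at the middle entry 1 of \<open>(1, s, 1, t, 1)\<close>.
\<close>

section \<open>Reflexive polytopes and lattice distances of facets\<close>

text \<open>Boundedness enters the duality arguments only through this fact: a direction along which
  all halfspace constraints stay satisfied must vanish.\<close>

lemma bounded_ray_zero:
  fixes a :: "'a::euclidean_space"
  assumes "bounded S" and "\<And>r. r \<ge> 0 \<Longrightarrow> r *\<^sub>R a \<in> S"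
  shows "a = 0"
proof (rule ccontr)
  assume "a \<noteq> 0"
  obtain B where B: "\<And>x. x \<in> S \<Longrightarrow> norm x \<le> B" "B > 0"
    using assms(1) bounded_pos by metis
  have "norm (((B + 1) / norm a) *\<^sub>R a) \<le> B"
    using B(2) by (intro B(1) assms(2)) simp
  with \<open>a \<noteq> 0\<close> B(2) show False by simp
qed

lemma int_points_inner: "x \<in> int_points \<Longrightarrow> y \<in> int_points \<Longrightarrow> x \<bullet> y \<in> \<int>"
  by (auto simp: int_points_def inner_vec_def intro!: Ints_sum)

lemma lattice_polytope_compact: "lattice_polytope P \<Longrightarrow> compact P"
  by (auto simp: lattice_polytope_def finite_imp_compact_convex_hull)

lemma lattice_polytope_affine_image:
  assumes "lattice_polytope P" and "w \<in> int_points"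
  shows "lattice_polytope ((\<lambda>x. real c *\<^sub>R x + w) ` P)"
proof -
  obtain V where V: "finite V" "V \<subseteq> int_points" "P = convex hull V"
    using assms(1) by (auto simp: lattice_polytope_def)
  have "(\<lambda>x. real c *\<^sub>R x + w) ` P = convex hull ((\<lambda>x. w + real c *\<^sub>R x) ` V)"
    by (simp add: V(3) convex_hull_affinity add.commute)
  moreover have "(\<lambda>x. w + real c *\<^sub>R x) ` V \<subseteq> int_points"
    using V(2) assms(2) by (auto simp: int_points_def)
  ultimately show ?thesis
    using V(1) by (auto simp: lattice_polytope_def)
qed

text \<open>If \<open>y\<close> lies outside the hull of the \<open>- n i\<close>, a functional
  \<open>a\<close> separates it strictly, with threshold \<open>b\<close>. For \<open>b < 0\<close>
  the point \<open>a / b\<close> lies in \<open>Q\<close> and pairs with \<open>y\<close> to more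
  than 1. For \<open>b \<ge> 0\<close> the whole ray through \<open>- a\<close> lies in
  \<open>Q\<close>, against boundedness.\<close>

lemma dual_halfspaces:
  fixes n :: "'i \<Rightarrow> real ^ 'n"
  assumes Q: "Q = {x. \<forall>i\<in>I. n i \<bullet> x \<ge> - 1}" and "finite I" and "bounded Q"
  shows "dual_polytope Q = convex hull ((\<lambda>i. - n i) ` I)"
proof
  \<comment> \<open>Without constraints \<open>Q\<close> would be the whole space. An index is
    needed later to refute \<open>a = 0\<close>.\<close>
  have "I \<noteq> {}"
    using assms(3) not_bounded_UNIV[where 'a = "real ^ 'n"] by (auto simp: Q)
  have cpt: "compact (convex hull ((\<lambda>i. - n i) ` I))"
    using \<open>finite I\<close> by (simp add: finite_imp_compact_convex_hull)
  show "dual_polytope Q \<subseteq> convex hull ((\<lambda>i. - n i) ` I)"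
  proof (rule subsetI, rule ccontr)
    fix y assume y: "y \<in> dual_polytope Q" "y \<notin> convex hull ((\<lambda>i. - n i) ` I)"
    obtain a b where ab: "a \<bullet> y < b" "\<And>x. x \<in> convex hull ((\<lambda>i. - n i) ` I) \<Longrightarrow> a \<bullet> x > b"
      using separating_hyperplane_closed_point[OF convex_convex_hull compact_imp_closed[OF cpt] y(2)]
      by blast
    have n: "n i \<bullet> a < - b" if "i \<in> I" for i
      using ab(2)[of "- n i"] that by (simp add: hull_inc inner_commute)
    show False
    proof (cases "b < 0")
      case True
      have "(1 / b) *\<^sub>R a \<in> Q"
        using n True by (force simp: Q field_simps)
      then have "((1 / b) *\<^sub>R a) \<bullet> y \<le> 1"
        using y(1) unfolding dual_polytope_def by blast
      with True ab(1) show False by (simp add: field_simps)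
    next
      case False
      have "r *\<^sub>R (- a) \<in> Q" if "r \<ge> 0" for r
      proof -
        have "r * (n i \<bullet> a) \<le> 0" if "i \<in> I" for i
          using n[OF that] False \<open>r \<ge> 0\<close> by (simp add: mult_nonneg_nonpos)
        then show ?thesis by (force simp: Q)
      qed
      then have "- a = 0"
        using bounded_ray_zero[OF \<open>bounded Q\<close>] by blast
      with n \<open>I \<noteq> {}\<close> ab(1) False show False by auto
    qed
  qed
  have "convex (dual_polytope Q)"
  proof -
    have "dual_polytope Q = (\<Inter>x\<in>Q. {y. x \<bullet> y \<le> 1})"
      by (auto simp: dual_polytope_def)
    then show ?thesis
      by (simp add: convex_INT convex_halfspace_le)
  qed
  moreover have "(\<lambda>i. - n i) ` I \<subseteq> dual_polytope Q"
    by (force simp: dual_polytope_def Q inner_commute)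
  ultimately show "convex hull ((\<lambda>i. - n i) ` I) \<subseteq> dual_polytope Q"
    by (rule hull_minimal[rotated])
qed

text \<open>At an interior lattice point each \<open>n i \<bullet> x\<close> is an integer above -1,
  hence nonnegative. The ray through \<open>x\<close> then stays in the bounded set
  \<open>Q\<close>, so \<open>x = 0\<close>. The dual is the hull of the lattice points
  \<open>- n i\<close>.\<close>

lemma reflexive_halfspaces:
  fixes n :: "'i \<Rightarrow> real ^ 'n"
  assumes Q: "Q = {x. \<forall>i\<in>I. n i \<bullet> x \<ge> - 1}" and fin: "finite I"
    and n: "\<And>i. i \<in> I \<Longrightarrow> n i \<in> int_points" and lat: "lattice_polytope Q"
  shows "reflexive Q"
proof -
  have bd: "bounded Q" and cl: "closed Q"
    using lattice_polytope_compact[OF lat] compact_imp_bounded compact_imp_closed by auto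
  define G where "G = (\<Inter>i\<in>I. {x. n i \<bullet> x > - 1})"
  have "open G" "0 \<in> G" "G \<subseteq> Q"
    using fin by (auto simp: G_def Q intro!: open_INT open_halfspace_gt) fastforce
  then have int0: "0 \<in> interior Q"
    using interior_maximal by blast
  have strict: "n i \<bullet> x > - 1" if x: "x \<in> interior Q" and i: "i \<in> I" for x i
  proof (rule ccontr)
    assume *: "\<not> ?thesis"
    obtain e where e: "e > 0" "ball x e \<subseteq> Q"
      using x mem_interior by blast
    have "n i \<noteq> 0" using * by auto
    \<comment> \<open>Moving against \<open>n i\<close> by half the radius stays inside the ball but
      lowers \<open>n i \<bullet> x\<close>, which is already at most -1.\<close>
    define y where "y = x - (e / (2 * norm (n i))) *\<^sub>R n i"
    have "y \<in> ball x e"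
      using e(1) \<open>n i \<noteq> 0\<close> by (simp add: y_def dist_norm)
    then have "n i \<bullet> y \<ge> - 1" using e(2) i Q by blast
    moreover have "n i \<bullet> y < n i \<bullet> x"
      using e(1) \<open>n i \<noteq> 0\<close> by (simp add: y_def inner_diff_right)
    ultimately show False using * by simp
  qed
  have "x = 0" if x: "x \<in> interior Q" "x \<in> int_points" for x
  proof (rule bounded_ray_zero[OF bd])
    fix r :: real assume "r \<ge> 0"
    have "n i \<bullet> x \<ge> 0" if i: "i \<in> I" for i
    proof -
      obtain m where "n i \<bullet> x = of_int m"
        using int_points_inner[OF n[OF i] x(2)] Ints_cases by blast
      then show ?thesis using strict[OF x(1) i] by simp
    qed
    then have "r * (n i \<bullet> x) \<ge> 0" if "i \<in> I" for i
      using \<open>r \<ge> 0\<close> that by simp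
    then show "r *\<^sub>R x \<in> Q" by (force simp: Q)
  qed
  moreover have "Q - frontier Q = interior Q"
    using cl interior_subset by (auto simp: frontier_def)
  moreover have "aff_dim Q = int CARD('n)"
    using aff_dim_nonempty_interior[of Q] int0 by auto
  moreover have "lattice_polytope (dual_polytope Q)"
    using dual_halfspaces[OF Q fin bd] fin n
    by (auto simp: lattice_polytope_def int_points_def intro!: exI[of _ "(\<lambda>i. - n i) ` I"])
  ultimately show ?thesis
    using int0 lat unfolding reflexive_def fano_def full_lattice_polytope_def
    by (auto simp: int_points_def)
qed

section \<open>Integer matrices of determinant 1 or -1\<close>

lemma det_map_matrix_of_int: "det (map_matrix real_of_int U) = real_of_int (det U)"
  by (simp add: det_def map_matrix_def)

lemma det_int_entries:
  fixes A :: "real ^ 'n ^ 'n"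
  assumes "\<And>i j. A $ i $ j \<in> \<int>"
  shows "det A \<in> \<int>"
  unfolding det_def using assms by (intro Ints_sum Ints_mult Ints_prod) auto

text \<open>By Cramer's rule the solution is a quotient of integer determinants, and the denominator
  is 1 or -1.\<close>

lemma unimodular_solve_int:
  fixes U :: "int ^ 'n ^ 'n"
  assumes "det U \<in> {1, - 1}" and "w \<in> int_points"
  obtains u where "u \<in> int_points" and "u v* map_matrix real_of_int U = w"
proof -
  \<comment> \<open>The transpose turns the row action \<open>v*\<close> into the column action for
    which Cramer's rule is stated.\<close>
  define A where "A = transpose (map_matrix real_of_int U)"
  have d: "det A = 1 \<or> det A = - 1"
    using assms(1) by (auto simp: A_def det_transpose det_map_matrix_of_int)
  define u where "u = (\<chi> k. det (\<chi> i j. if j = k then w $ i else A $ i $ j) / det A)"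
  have "A *v u = w"
    using cramer[of A u w] d by (auto simp: u_def)
  moreover have "u \<in> int_points"
  proof -
    have "det (\<chi> i j. if j = k then w $ i else A $ i $ j) \<in> \<int>" for k
      using assms(2)
      by (intro det_int_entries) (auto simp: int_points_def A_def transpose_def map_matrix_def)
    then show ?thesis using d by (auto simp: int_points_def u_def)
  qed
  ultimately show ?thesis
    using that by (simp add: A_def)
qed

text \<open>Strict constraints survive a small move by continuity, tight ones are constant along
  \<open>z\<close>, and finiteness allows a common step length.\<close>

lemma halfspaces_perturb:
  fixes n :: "'i \<Rightarrow> real ^ 'n"
  assumes "finite I" and "\<And>j. j \<in> I \<Longrightarrow> n j \<bullet> p + h j > 0 \<or> (n j \<bullet> p + h j = 0 \<and> n j \<bullet> z = 0)"
  shows "\<exists>e>0. \<forall>j\<in>I. n j \<bullet> (p + e *\<^sub>R z) + h j \<ge> 0"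
proof -
  have "\<forall>\<^sub>F e in at_right 0. n j \<bullet> (p + e *\<^sub>R z) + h j \<ge> 0" if "j \<in> I" for j
  proof (cases "n j \<bullet> p + h j > 0")
    case True
    have "((\<lambda>e. n j \<bullet> (p + e *\<^sub>R z) + h j) \<longlongrightarrow> n j \<bullet> (p + 0 *\<^sub>R z) + h j) (at_right 0)"
      by (intro tendsto_intros)
    then have "\<forall>\<^sub>F e in at_right 0. n j \<bullet> (p + e *\<^sub>R z) + h j > 0"
      using True by (intro order_tendstoD(1)[where a = 0]) auto
    then show ?thesis by (rule eventually_mono) simp
  next
    case False
    then show ?thesis using assms(2)[OF that] by (simp add: inner_add_right)
  qed
  then have "\<forall>\<^sub>F e in at_right 0. \<forall>j\<in>I. n j \<bullet> (p + e *\<^sub>R z) + h j \<ge> 0"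
    using assms(1) by (simp add: eventually_ball_finite)
  moreover have "\<forall>\<^sub>F e::real in at_right 0. e > 0"
    by (simp add: eventually_at_right_less)
  ultimately have "\<forall>\<^sub>F e in at_right 0. e > 0 \<and> (\<forall>j\<in>I. n j \<bullet> (p + e *\<^sub>R z) + h j \<ge> 0)"
    by eventually_elim auto
  then show ?thesis
    using eventually_happens trivial_limit_at_right_real by blast
qed

text \<open>A converse to \<open>reflexive_halfspaces\<close>. Let \<open>H\<close> be the value of
  the \<open>i\<close>-th facet function at the lattice point \<open>u\<close> sent to 0. Up to the
  matrix, the dual vertex belonging to this facet is \<open>- n i / H\<close>. It is a lattice
  vector, so primitivity of \<open>n i\<close> makes \<open>1 / H\<close> an integer, and
  \<open>H = 1\<close>.\<close>

lemma unimodular_reflexive_facets: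
  fixes n :: "'i \<Rightarrow> real ^ 'n"
  assumes R: "R = {x. \<forall>i\<in>I. n i \<bullet> x + h i \<ge> 0}" and fin: "finite I"
    and n: "\<And>i. i \<in> I \<Longrightarrow> n i \<in> int_points" and h: "\<And>i. i \<in> I \<Longrightarrow> h i \<in> \<int>"
    and prim: "\<And>i. i \<in> I \<Longrightarrow> \<exists>z\<in>int_points. n i \<bullet> z = 1"
    and facet: "\<And>i. i \<in> I \<Longrightarrow> \<exists>p. n i \<bullet> p + h i = 0 \<and> (\<forall>j\<in>I - {i}. n j \<bullet> p + h j > 0)"
    and Q: "reflexive Q" and equiv: "unimodularly_equivalent R Q"
  shows "\<exists>u\<in>int_points. \<forall>i\<in>I. n i \<bullet> u + h i = 1"
proof -
  obtain U :: "int ^ 'n ^ 'n" and w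
    where U: "det U \<in> {1, - 1}" and w: "w \<in> int_points"
      and QR: "Q = (\<lambda>v. v v* map_matrix real_of_int U + w) ` R"
    using equiv unfolding unimodularly_equivalent_def by blast
  define A where "A = map_matrix real_of_int U"
  have "- w \<in> int_points" using w by (simp add: int_points_def)
  \<comment> \<open>\<open>u\<close> is the lattice point that the equivalence maps to 0.\<close>
  then obtain u where u: "u \<in> int_points" "u v* A = - w"
    using unimodular_solve_int[OF U] unfolding A_def by blast
  have QR': "Q = (\<lambda>x. (x - u) v* A) ` R"
    using u(2) unfolding QR A_def[symmetric] by (simp add: vector_matrix_mult_diff_distrib)
  have "det A \<noteq> 0"
    using U by (auto simp: A_def det_map_matrix_of_int)
  then have inv: "invertible A" by (simp add: invertible_det_nz)
  have inj: "x = y" if "x v* A = y v* A" for x y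
  proof -
    have "x \<bullet> (A *v z) = y \<bullet> (A *v z)" for z
      using that by (metis dot_lmul_matrix)
    moreover obtain B where "A ** B = mat 1" using inv invertible_def by blast
    ultimately have "x \<bullet> z = y \<bullet> z" for z
      by (metis matrix_vector_mul_assoc matrix_vector_mul_lid)
    then show ?thesis using vector_eq_rdot[of x y] by simp
  qed
  have surj: "\<exists>y. A *v y = z" for z
    using matrix_right_invertible_surjective[of A] inv unfolding invertible_def surj_def by metis
  have latQ: "lattice_polytope Q" "lattice_polytope (dual_polytope Q)"
    and "0 \<in> Q - frontier Q"
    using Q by (auto simp: reflexive_def fano_def full_lattice_polytope_def)
  then have "0 \<in> interior Q"
    using closure_subset by (auto simp: frontier_def)
  then obtain e where e: "e > 0" "ball 0 e \<subseteq> Q"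
    using mem_interior by blast
  \<comment> \<open>Since 0 is interior to \<open>Q\<close>, the point \<open>u\<close> is interior
    to \<open>R\<close>: one can leave \<open>u\<close> in any direction. Applied to
    \<open>- n i\<close>, this makes every facet function positive at \<open>u\<close>.\<close>
  have near: "\<exists>\<delta>>0. u + \<delta> *\<^sub>R z \<in> R" for z
  proof -
    define \<delta> where "\<delta> = e / (norm (z v* A) + 1)"
    have "\<delta> > 0" using e(1) by (simp add: \<delta>_def add_nonneg_pos)
    have "\<delta> * norm (z v* A) < e"
      using e(1) by (simp add: \<delta>_def divide_simps add_nonneg_pos) 
    then have "(\<delta> *\<^sub>R z) v* A \<in> ball 0 e"
      using \<open>\<delta> > 0\<close> by (simp add: scaleR_vector_matrix_assoc)
    then obtain x where "x \<in> R" "(\<delta> *\<^sub>R z) v* A = (x - u) v* A"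
      using e(2) QR' by blast
    then have "u + \<delta> *\<^sub>R z = x" using inj by fastforce
    with \<open>\<delta> > 0\<close> \<open>x \<in> R\<close> show ?thesis by auto
  qed
  have pos: "n i \<bullet> u + h i > 0" if i: "i \<in> I" for i
  proof -
    obtain \<delta> where d: "\<delta> > 0" "u + \<delta> *\<^sub>R (- n i) \<in> R" using near by blast
    then have "n i \<bullet> (u + \<delta> *\<^sub>R (- n i)) + h i \<ge> 0" using i by (simp add: R)
    moreover have "n i \<noteq> 0" using prim[OF i] by auto
    then have "\<delta> * (n i \<bullet> n i) > 0" using d(1) by simp
    ultimately show ?thesis by (simp add: inner_diff_right)
  qed
  obtain V where V: "finite V" "V \<subseteq> int_points" "dual_polytope Q = convex hull V"
    using latQ(2) by (auto simp: lattice_polytope_def)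
  have "n i \<bullet> u + h i = 1" if i: "i \<in> I" for i
  proof -
    define H where "H = n i \<bullet> u + h i"
    have "H > 0" using pos[OF i] by (simp add: H_def)
    obtain p where p: "n i \<bullet> p + h i = 0" "\<And>j. j \<in> I \<Longrightarrow> j \<noteq> i \<Longrightarrow> n j \<bullet> p + h j > 0"
      using facet[OF i] by blast
    \<comment> \<open>\<open>y\<close> is the dual point cut out by facet \<open>i\<close>: its
      pairing with the image of \<open>x\<close> is at most 1 on \<open>R\<close>, with equality
      exactly where the facet function vanishes.\<close>
    obtain y where y: "A *v y = (- 1 / H) *\<^sub>R n i" using surj by blast
    have dot: "((x - u) v* A) \<bullet> y = 1 - (n i \<bullet> x + h i) / H" for x
    proof -
      have "((x - u) v* A) \<bullet> y = (n i \<bullet> u - n i \<bullet> x) / H"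
        unfolding dot_lmul_matrix y
        by (simp add: inner_diff_right inner_commute[of "x - u"] diff_divide_distrib)
      then show ?thesis using \<open>H > 0\<close> by (simp add: field_simps) (simp add: H_def)
    qed
    have "y \<in> dual_polytope Q"
      using i \<open>H > 0\<close> by (auto simp: dual_polytope_def QR' R dot)
    then have "y \<in> convex hull V" using V(3) by simp
    \<comment> \<open>The dual attains the value 1 at the facet point \<open>p\<close>, hence at a lattice point \<open>v\<close>; as \<open>p\<close> can be
      moved both ways inside its facet, \<open>v\<close> must be normal to the facet, so \<open>v = - n i / H\<close> up to \<open>A\<close>.\<close>
    have "\<exists>v\<in>V. ((p - u) v* A) \<bullet> v \<ge> 1"
    proof (rule ccontr)
      assume "\<not> ?thesis"
      then have "V \<subseteq> {v. ((p - u) v* A) \<bullet> v < 1}" by auto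
      then have "convex hull V \<subseteq> {v. ((p - u) v* A) \<bullet> v < 1}"
        by (rule hull_minimal) (rule convex_halfspace_lt)
      with \<open>y \<in> convex hull V\<close> dot[of p] p(1) show False by auto
    qed
    then obtain v where v: "v \<in> V" "((p - u) v* A) \<bullet> v \<ge> 1" by blast
    define v' where "v' = A *v v"
    have le: "(x - u) \<bullet> v' \<le> 1" if "x \<in> R" for x
    proof -
      have "v \<in> dual_polytope Q" using v(1) V(3) by (simp add: hull_inc)
      then show ?thesis
        using that by (auto simp: dual_polytope_def QR' v'_def dot_lmul_matrix)
    qed
    have "p \<in> R" using p by (force simp: R)
    then have p1: "(p - u) \<bullet> v' = 1"
      using le v(2) by (intro antisym) (auto simp: v'_def dot_lmul_matrix)
    have nonpos: "z \<bullet> v' \<le> 0" if "n i \<bullet> z = 0" for z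
    proof -
      have "\<exists>\<delta>>0. \<forall>j\<in>I. n j \<bullet> (p + \<delta> *\<^sub>R z) + h j \<ge> 0"
        using p that by (intro halfspaces_perturb[OF fin]) auto
      then obtain \<delta> where d: "\<delta> > 0" "p + \<delta> *\<^sub>R z \<in> R" by (auto simp: R)
      have "p + \<delta> *\<^sub>R z - u = (p - u) + \<delta> *\<^sub>R z" by simp
      then have "(p - u) \<bullet> v' + \<delta> * (z \<bullet> v') \<le> 1"
        using le[OF d(2)] by (metis inner_add_left inner_scaleR_left)
      then have "\<delta> * (z \<bullet> v') \<le> 0" using p1 by simp
      then show ?thesis using d(1) by (simp add: mult_le_0_iff)
    qed
    have "n i \<noteq> 0" using prim[OF i] by auto
    define l where "l = (n i \<bullet> v') / (n i \<bullet> n i)"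
    \<comment> \<open>\<open>z\<close> is the component of \<open>v'\<close> orthogonal to
      \<open>n i\<close>. Both \<open>z\<close> and \<open>- z\<close> are directions inside the
      facet, so \<open>z \<bullet> v' = 0\<close>, and hence \<open>z = 0\<close>.\<close>
    define z where "z = v' - l *\<^sub>R n i"
    have nz: "n i \<bullet> z = 0" using \<open>n i \<noteq> 0\<close> by (simp add: z_def l_def inner_diff_right)
    have "z \<bullet> v' = 0" using nonpos[OF nz] nonpos[of "- z"] nz by simp
    then have "z \<bullet> z = 0"
      using nz by (simp add: z_def inner_diff_right inner_diff_left inner_commute)
    then have v'l: "v' = l *\<^sub>R n i" by (simp add: z_def)
    have lH: "- (l * H) = 1"
    proof -
      have "n i \<bullet> p = - h i" using p(1) by simp
      then show ?thesis
        using p1 by (simp add: v'l H_def inner_diff_left inner_commute[of _ "n i"] algebra_simps)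
    qed
    have "v' \<in> int_points"
      using v(1) V(2)
      by (auto simp: v'_def A_def int_points_def matrix_vector_mult_def map_matrix_def
          intro!: Ints_sum)
    moreover obtain q where q: "q \<in> int_points" "n i \<bullet> q = 1" using prim[OF i] by blast
    ultimately have "l \<in> \<int>"
      using int_points_inner[of v' q] by (simp add: v'l)
    moreover have "H \<in> \<int>"
      unfolding H_def using int_points_inner[OF n[OF i] u(1)] h[OF i] by simp
    ultimately obtain a b where ab: "l = of_int a" "H = of_int b"
      using Ints_cases by metis
    then have "- (a * b) = 1" using lH by (metis of_int_eq_1_iff of_int_minus of_int_mult)
    \<comment> \<open>\<open>l\<close> and \<open>H\<close> are integers with product -1, so
      \<open>H\<close> is a unit, and its positivity leaves only 1.\<close>
    then have "b dvd 1" by (metis dvd_minus_iff dvd_triv_right)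
    then have "b = 1" using \<open>H > 0\<close> ab by simp
    then show ?thesis using ab H_def by simp
  qed
  with u(1) show ?thesis by blast
qed

section \<open>Facets and vertices of the lecture hall polytope\<close>

text \<open>The border values 0 and \<open>c\<close> let the first and last inequality of the chain
  follow the pattern of the inner ones. The true coordinates occupy positions 1 to
  \<open>CARD('n)\<close>.\<close>

definition ext_coord :: "real \<Rightarrow> real ^ 'n::{finite,linorder} \<Rightarrow> nat \<Rightarrow> real" where
  "ext_coord c x i = (0 # coords x @ [c]) ! i"

text \<open>The vector representing the linear part of \<open>ext_coord\<close> at a position. It is
  0 at both border positions, whose values are constants.\<close>

definition unit_coord :: "nat \<Rightarrow> real ^ 'n::{finite,linorder}" where
  "unit_coord i = (if i = 0 \<or> CARD('n) < i then 0 else axis (sorted_list_of_set UNIV ! (i - 1)) 1)"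

definition bordered :: "nat list \<Rightarrow> nat list" where
  "bordered s = 1 # s @ [1]"

text \<open>The quotients by the gcd are exact and make the normal vector primitive.\<close>

definition facet_normal :: "nat list \<Rightarrow> nat \<Rightarrow> real ^ 'n::{finite,linorder}" where
  "facet_normal s i =
     real (bordered s ! i div gcd (bordered s ! i) (bordered s ! Suc i)) *\<^sub>R unit_coord (Suc i) -
     real (bordered s ! Suc i div gcd (bordered s ! i) (bordered s ! Suc i)) *\<^sub>R unit_coord i"

text \<open>Only the last facet function involves the constant border value. Its coefficient is not
  divided by a gcd, because the neighbouring border entry 1 makes that gcd equal to 1. The offset is
  the one for dilation factor 1.\<close>

definition facet_offset :: "nat list \<Rightarrow> nat \<Rightarrow> real" where
  "facet_offset s i = (if i = length s then real (bordered s ! i) else 0)"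

section \<open>Coordinates with border values\<close>

lemma bij_betw_sorted_index:
  "bij_betw (\<lambda>i. sorted_list_of_set (UNIV :: 'n::{finite,linorder} set) ! i) {..<CARD('n::{finite,linorder})} UNIV"
  by (rule bij_betw_nth) auto

lemma length_coords: "length (coords (x :: real ^ 'n::{finite,linorder})) = CARD('n)"
  by (simp add: coords_def)

lemma ext_coord_simps:
  fixes x :: "real ^ 'n::{finite,linorder}"
  shows "ext_coord c x 0 = 0"
    and "ext_coord c x (Suc CARD('n)) = c"
    and "i < CARD('n) \<Longrightarrow> ext_coord c x (Suc i) = x $ (sorted_list_of_set UNIV ! i)"
  by (simp_all add: ext_coord_def nth_append length_coords) (simp add: coords_def)

lemma unit_coord_inner:
  fixes x :: "real ^ 'n::{finite,linorder}"
  assumes "i \<le> Suc CARD('n)"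
  shows "unit_coord i \<bullet> x = ext_coord c x i - (if i = Suc CARD('n) then c else 0)"
proof (cases i)
  case (Suc j)
  then show ?thesis using assms
    by (cases "j < CARD('n)") (auto simp: unit_coord_def ext_coord_simps inner_axis' not_less)
qed (simp add: unit_coord_def ext_coord_simps)

text \<open>Supplies all explicit points below: vertices, facet points, Bezout vectors, and the
  lattice point built from an integer chain.\<close>

lemma ext_coord_exists:
  fixes Y :: "nat \<Rightarrow> real"
  assumes "Y 0 = 0" and "Y (Suc CARD('n::{finite,linorder})) = c"
  obtains x :: "real ^ 'n::{finite,linorder}"
  where "\<And>i. i \<le> Suc CARD('n) \<Longrightarrow> ext_coord c x i = Y i"
    and "(\<forall>i. Y i \<in> \<int>) \<longrightarrow> x \<in> int_points"
proof -
  let ?e = "\<lambda>i. sorted_list_of_set (UNIV :: 'n set) ! i"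
  define x :: "real ^ 'n::{finite,linorder}" where "x = (\<chi> j. Y (Suc (inv_into {..<CARD('n)} ?e j)))"
  have "ext_coord c x i = Y i" if "i \<le> Suc CARD('n)" for i
  proof (cases i)
    case (Suc j)
    have "x $ ?e j = Y (Suc j)" if "j < CARD('n)"
      using bij_betw_inv_into_left[OF bij_betw_sorted_index[where 'n = 'n]] that by (simp add: x_def)
    then show ?thesis using Suc assms that
      by (cases "j < CARD('n)") (auto simp: ext_coord_simps not_less le_Suc_eq)
  qed (simp add: ext_coord_simps assms)
  moreover have "(\<forall>i. Y i \<in> \<int>) \<longrightarrow> x \<in> int_points"
    by (simp add: int_points_def x_def)
  ultimately show ?thesis using that by blast
qed

lemma ext_coord_inject:
  fixes x y :: "real ^ 'n::{finite,linorder}"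
  assumes "\<And>i. i \<le> CARD('n) \<Longrightarrow> ext_coord c x i = ext_coord c y i"
  shows "x = y"
proof (rule vec_eq_iff[THEN iffD2, rule_format])
  fix j :: 'n
  obtain i where "i < CARD('n)" "j = sorted_list_of_set UNIV ! i"
    using bij_betw_imp_surj_on[OF bij_betw_sorted_index[where 'n = 'n]] by blast
  then show "x $ j = y $ j"
    using assms[of "Suc i"] by (simp add: ext_coord_simps)
qed

lemma ext_coord_scale:
  fixes x :: "real ^ 'n::{finite,linorder}"
  assumes "i \<le> Suc CARD('n)"
  shows "ext_coord (c * b) (c *\<^sub>R x) i = c * ext_coord b x i"
  using unit_coord_inner[OF assms, of "c *\<^sub>R x" "c * b"] unit_coord_inner[OF assms, of x b]
  by (auto simp: algebra_simps split: if_splits)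

lemma ext_coord_int:
  fixes x :: "real ^ 'n::{finite,linorder}"
  assumes "x \<in> int_points" and "c \<in> \<int>" and "i \<le> Suc CARD('n)"
  shows "ext_coord c x i \<in> \<int>"
proof (cases i)
  case (Suc j)
  then show ?thesis using assms
    by (cases "j < CARD('n)") (auto simp: ext_coord_simps int_points_def not_less le_Suc_eq)
qed (simp add: ext_coord_simps)

section \<open>Halfspaces and vertices of the dilated polytope\<close>

lemma bordered_pos:
  assumes "\<forall>m\<in>set s. 0 < m" and "i \<le> Suc (length s)"
  shows "0 < bordered s ! i"
proof -
  have "bordered s ! i \<in> set (bordered s)"
    using assms(2) by (intro nth_mem) (simp add: bordered_def)
  with assms(1) show ?thesis by (auto simp: bordered_def)
qed

lemma bordered_ends: "bordered s ! 0 = 1" "bordered s ! Suc (length s) = 1"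
  by (simp_all add: bordered_def)

lemma facet_normal_inner:
  fixes x :: "real ^ 'n::{finite,linorder}"
  assumes "length s = CARD('n)" and "i \<le> CARD('n)"
  shows "facet_normal s i \<bullet> x + c * facet_offset s i =
    (real (bordered s ! i) * ext_coord c x (Suc i) - real (bordered s ! Suc i) * ext_coord c x i) /
    real (gcd (bordered s ! i) (bordered s ! Suc i))"
proof -
  let ?g = "gcd (bordered s ! i) (bordered s ! Suc i)"
  have "facet_normal s i \<bullet> x =
      real (bordered s ! i) / real ?g * (unit_coord (Suc i) \<bullet> x) -
      real (bordered s ! Suc i) / real ?g * (unit_coord i \<bullet> x)"
    by (simp add: facet_normal_def inner_diff_left real_of_nat_div)
  moreover have "unit_coord i \<bullet> x = ext_coord c x i"
    using unit_coord_inner[of i x c] assms(2) by simp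
  moreover have "unit_coord (Suc i) \<bullet> x = ext_coord c x (Suc i) - (if i = CARD('n) then c else 0)"
    using unit_coord_inner[of "Suc i" x c] assms(2) by simp
  \<comment> \<open>At the last facet the offset, which is not divided by the gcd, restores exactly
    the term in \<open>c\<close> that \<open>unit_coord\<close> drops.\<close>
  moreover have "?g = 1" if "i = CARD('n)"
    unfolding that assms(1)[symmetric] bordered_ends by simp
  ultimately show ?thesis
    by (cases "i = CARD('n)")
      (simp_all add: facet_offset_def assms(1) diff_divide_distrib right_diff_distrib)
qed

lemma lecture_hall_quotients:
  fixes x :: "real ^ 'n::{finite,linorder}"
  assumes "length s = CARD('n)"
  shows "x \<in> lecture_hall s \<longleftrightarrow>
    (\<forall>i\<le>CARD('n). ext_coord 1 x i / real (bordered s ! i) \<le> ext_coord 1 x (Suc i) / real (bordered s ! Suc i))"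
proof -
  define xs where "xs = 0 # coords x @ [1]"
  define L where "L = map2 (\<lambda>a m. a / real m) xs (bordered s)"
  have "0 # map2 (\<lambda>a m. a / real m) (coords x) s @ [1] = L"
    using assms by (simp add: L_def xs_def bordered_def length_coords)
  moreover have len: "length xs = Suc (Suc CARD('n))" "length (bordered s) = Suc (Suc CARD('n))"
    using assms by (simp_all add: xs_def bordered_def length_coords)
  then have "L ! i = ext_coord 1 x i / real (bordered s ! i)" if "i \<le> Suc CARD('n)" for i
    unfolding ext_coord_def xs_def[symmetric] L_def using that by simp
  moreover have "length L = Suc (Suc CARD('n))"
    using len by (simp add: L_def)
  ultimately show ?thesis
    unfolding lecture_hall_def mem_Collect_eq sorted_iff_nth_Suc by (simp add: less_Suc_eq_le)
qed

lemma facet_ge_iff: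
  fixes x :: "real ^ 'n::{finite,linorder}"
  assumes "length s = CARD('n)" and "\<forall>m\<in>set s. 0 < m" and "i \<le> CARD('n)"
  shows "0 \<le> facet_normal s i \<bullet> x + c * facet_offset s i \<longleftrightarrow>
    ext_coord c x i / real (bordered s ! i) \<le> ext_coord c x (Suc i) / real (bordered s ! Suc i)"
proof -
  have "0 < real (bordered s ! i)" "0 < real (bordered s ! Suc i)"
    using bordered_pos[OF assms(2)] assms by auto
  moreover from this have "0 < real (gcd (bordered s ! i) (bordered s ! Suc i))" by simp
  ultimately show ?thesis
    unfolding facet_normal_inner[OF assms(1,3)]
    by (simp add: zero_le_divide_iff pos_le_divide_eq pos_divide_le_eq mult.commute)
qed

lemma lecture_hall_scaled:
  fixes s :: "nat list"
  assumes "length s = CARD('n::{finite,linorder})" and "\<forall>m\<in>set s. 0 < m" and "c > 0"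
  shows "(\<lambda>x. c *\<^sub>R x) ` (lecture_hall s :: (real ^ 'n::{finite,linorder}) set) =
    {x. \<forall>i\<in>{..CARD('n)}. facet_normal s i \<bullet> x + c * facet_offset s i \<ge> 0}"
    (is "?l = ?r")
proof -
  have iff: "c *\<^sub>R x \<in> ?r \<longleftrightarrow> x \<in> lecture_hall s" for x :: "real ^ 'n::{finite,linorder}"
  proof -
    have "ext_coord c (c *\<^sub>R x) i = c * ext_coord 1 x i" if "i \<le> Suc CARD('n)" for i
      using ext_coord_scale[OF that, of c 1 x] by simp
    then show ?thesis
      using assms(3)
      by (simp add: facet_ge_iff[OF assms(1,2)] lecture_hall_quotients[OF assms(1)] Ball_def
          mult_le_cancel_left_pos flip: times_divide_eq_right)
  qed
  show ?thesis
  proof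
    show "?l \<subseteq> ?r" using iff by blast
    show "?r \<subseteq> ?l"
    proof
      fix x :: "real ^ 'n::{finite,linorder}" assume "x \<in> ?r"
      moreover have "x = c *\<^sub>R ((1 / c) *\<^sub>R x)" using assms(3) by simp
      ultimately show "x \<in> ?l"
        using iff[of "(1 / c) *\<^sub>R x"] by (intro image_eqI[of x _ "(1 / c) *\<^sub>R x"]) simp_all
    qed
  qed
qed

text \<open>The polytope is a simplex: vertex \<open>v j\<close> has its first \<open>j\<close>
  coordinates 0 and the others equal to the entries of \<open>s\<close>. The barycentric coordinates
  of \<open>x\<close> are the successive differences of the quotients
  \<open>x\<^sub>i / s\<^sub>i\<close>, bordered by 0 and 1.\<close>

lemma lattice_polytope_lecture_hall:
  fixes s :: "nat list"
  assumes len: "length s = CARD('n::{finite,linorder})" and pos: "\<forall>m\<in>set s. 0 < m"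
  shows "lattice_polytope (lecture_hall s :: (real ^ 'n::{finite,linorder}) set)"
proof -
  let ?d = "CARD('n)"
  let ?P = "lecture_hall s :: (real ^ 'n::{finite,linorder}) set"
  have "\<exists>v :: real ^ 'n::{finite,linorder}. v \<in> int_points \<and>
      (\<forall>i\<le>Suc ?d. ext_coord 1 v i = (if j < i then real (bordered s ! i) else 0))" if "j \<le> ?d" for j
  proof -
    let ?Y = "\<lambda>i. if j < i then real (bordered s ! i) else 0"
    have "?Y 0 = 0" "?Y (Suc ?d) = 1" "\<forall>i. ?Y i \<in> \<int>"
      using that len bordered_ends(2)[of s] by auto
    then show ?thesis
      using ext_coord_exists[where 'n = 'n and c = 1 and Y = ?Y] by metis
  qed
  then obtain v :: "nat \<Rightarrow> real ^ 'n::{finite,linorder}" where v_int: "\<And>j. j \<le> ?d \<Longrightarrow> v j \<in> int_points"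
    and v: "\<And>i j. j \<le> ?d \<Longrightarrow> i \<le> Suc ?d \<Longrightarrow>
      ext_coord 1 (v j) i = (if j < i then real (bordered s ! i) else 0)"
    by metis
  have barp: "0 < bordered s ! i" if "i \<le> Suc ?d" for i
    using bordered_pos[OF pos, of i] that len by simp
  have v_mem: "v j \<in> ?P" if "j \<le> ?d" for j
  proof -
    have "ext_coord 1 (v j) i / real (bordered s ! i) \<le> ext_coord 1 (v j) (Suc i) / real (bordered s ! Suc i)"
      if "i \<le> ?d" for i
      using barp[of i] barp[of "Suc i"] \<open>j \<le> ?d\<close> that by (simp add: v)
    then show ?thesis by (simp add: lecture_hall_quotients[OF len])
  qed
  have conv: "convex ?P"
  proof -
    have "?P = (\<Inter>i\<in>{..?d}. {x. facet_normal s i \<bullet> x \<ge> - facet_offset s i})"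
    proof -
      have "0 \<le> facet_normal s i \<bullet> x + facet_offset s i \<longleftrightarrow>
          - facet_offset s i \<le> facet_normal s i \<bullet> x" for i and x :: "real ^ 'n::{finite,linorder}"
        by auto
      then show ?thesis
        using lecture_hall_scaled[OF len pos, of 1] by auto
    qed
    then show ?thesis by (simp add: convex_INT convex_halfspace_ge)
  qed
  have "?P = convex hull (v ` {..?d})"
  proof
    show "convex hull (v ` {..?d}) \<subseteq> ?P"
      by (rule hull_minimal) (use v_mem conv in auto)
    show "?P \<subseteq> convex hull (v ` {..?d})"
    proof
      fix x assume x: "x \<in> ?P"
      define y where "y i = ext_coord 1 x i / real (bordered s ! i)" for i
      define l where "l j = y (Suc j) - y j" for j
      have l0: "l j \<ge> 0" if "j \<le> ?d" for j
        using x that by (simp add: lecture_hall_quotients[OF len] l_def y_def)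
      have y0: "y 0 = 0" "y (Suc ?d) = 1"
        using bordered_ends(2)[of s] len by (simp_all add: y_def ext_coord_simps)
      have l1: "sum l {..?d} = 1"
        unfolding lessThan_Suc_atMost[symmetric] l_def sum_lessThan_telescope y0 by simp
      have "x = (\<Sum>j\<le>?d. l j *\<^sub>R v j)"
      proof (rule ext_coord_inject[where c = 1])
        fix i assume i: "i \<le> ?d"
        have unit: "unit_coord i \<bullet> z = ext_coord 1 z i" for z :: "real ^ 'n::{finite,linorder}"
          using unit_coord_inner[of i z 1] i by simp
        have "ext_coord 1 (\<Sum>j\<le>?d. l j *\<^sub>R v j) i = (\<Sum>j\<le>?d. l j * ext_coord 1 (v j) i)"
          by (simp flip: unit add: inner_sum_right)
        also have "\<dots> = (\<Sum>j\<le>?d. if j < i then l j * real (bordered s ! i) else 0)"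
          using i by (intro sum.cong) (auto simp: v)
        \<comment> \<open>Only vertices with \<open>j < i\<close> have a nonzero \<open>i\<close>-th
          coordinate, so the weights telescope to \<open>y i - y 0\<close>.\<close>
        also have "\<dots> = (\<Sum>j<i. l j * real (bordered s ! i))"
          using i by (intro sum.mono_neutral_cong_right) auto
        also have "\<dots> = (y i - y 0) * real (bordered s ! i)"
          unfolding sum_distrib_right[symmetric] l_def sum_lessThan_telescope ..
        also have "\<dots> = ext_coord 1 x i"
          using barp[of i] i by (simp add: y0) (simp add: y_def)
        finally show "ext_coord 1 x i = ext_coord 1 (\<Sum>j\<le>?d. l j *\<^sub>R v j) i" ..
      qed
      moreover have "(\<Sum>j\<le>?d. l j *\<^sub>R v j) \<in> convex hull (v ` {..?d})"
        using l0 l1 by (intro convex_sum) (auto intro: hull_inc)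
      ultimately show "x \<in> convex hull (v ` {..?d})" by simp
    qed
  qed
  then show ?thesis
    using v_int by (auto simp: lattice_polytope_def intro!: exI[of _ "v ` {..?d}"])
qed

section \<open>The Gorenstein property as a chain of integer equations\<close>

text \<open>\<open>W\<close> lists the bordered coordinates of a lattice point at lattice distance 1
  from every facet. Multiplying by the gcd keeps the equations free of division.\<close>

definition facet_steps :: "nat list \<Rightarrow> nat \<Rightarrow> (nat \<Rightarrow> int) \<Rightarrow> bool" where
  "facet_steps a k W \<longleftrightarrow> W 0 = 0 \<and> W (length a - 1) = int k \<and>
     (\<forall>i<length a - 1. int (a ! i) * W (Suc i) - int (a ! Suc i) * W i = int (gcd (a ! i) (a ! Suc i)))"

lemma facet_normal_int:
  fixes s :: "nat list"
  shows "(facet_normal s i :: real ^ 'n::{finite,linorder}) \<in> int_points"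
  unfolding facet_normal_def int_points_def unit_coord_def
  by (auto simp: axis_def)

text \<open>Bezout coefficients of two neighbouring entries are the coordinates of \<open>z\<close>,
  up to sign. At an end facet one of them would fall on a border position and must be 0, which the
  border entry 1 permits. As \<open>CARD('n)\<close> is positive, no facet is at both ends.\<close>

lemma facet_normal_primitive:
  fixes s :: "nat list"
  assumes len: "length s = CARD('n::{finite,linorder})" and pos: "\<forall>m\<in>set s. 0 < m"
    and i: "i \<le> CARD('n)"
  shows "\<exists>z\<in>int_points. (facet_normal s i :: real ^ 'n::{finite,linorder}) \<bullet> z = 1"
proof -
  let ?a = "bordered s ! i" and ?b = "bordered s ! Suc i"
  have "\<exists>p q. p * int ?a + q * int ?b = int (gcd ?a ?b) \<and>
    (i = 0 \<longrightarrow> q = 0) \<and> (i = CARD('n) \<longrightarrow> p = 0)"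
  proof -
    consider "i = 0" | "i = CARD('n)" "i \<noteq> 0" | "i \<noteq> 0" "i \<noteq> CARD('n)" by blast
    then show ?thesis
    proof cases
      case 1
      then show ?thesis by (intro exI[of _ 1] exI[of _ 0]) (simp add: bordered_ends)
    next
      case 2
      then have "?b = 1" using len bordered_ends(2)[of s] by simp
      with 2 show ?thesis by (intro exI[of _ 0] exI[of _ 1]) simp
    next
      case 3
      then show ?thesis using bezout_int[of "int ?a" "int ?b"] by auto
    qed
  qed
  then obtain p q where pq: "p * int ?a + q * int ?b = int (gcd ?a ?b)"
    "i = 0 \<Longrightarrow> q = 0" "i = CARD('n) \<Longrightarrow> p = 0" by blast
  define Y where "Y j = (if j = Suc i then real_of_int p else if j = i then - real_of_int q else 0)" for j
  have "Y 0 = 0" "Y (Suc CARD('n)) = 0" "\<forall>j. Y j \<in> \<int>"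
    using pq i by (auto simp: Y_def)
  \<comment> \<open>Border value 0 removes the offset, leaving the pairing with the normal
    alone.\<close>
  then obtain z :: "real ^ 'n::{finite,linorder}"
    where z: "\<And>j. j \<le> Suc CARD('n) \<Longrightarrow> ext_coord 0 z j = Y j" "z \<in> int_points"
    using ext_coord_exists[of Y 0] by metis
  have "gcd ?a ?b \<noteq> 0"
    using bordered_pos[OF pos, of i] i len by simp
  moreover have "real ?a * real_of_int p + real ?b * real_of_int q = real (gcd ?a ?b)"
    using arg_cong[OF pq(1), of real_of_int] by (simp add: mult.commute)
  ultimately have "facet_normal s i \<bullet> z = 1"
    using facet_normal_inner[OF len i, of z 0] i by (simp add: z Y_def)
  with z(2) show ?thesis by blast
qed

text \<open>The quotients climb from 0 to \<open>c\<close> in \<open>CARD('n)\<close> equal steps,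
  with one flat step from position \<open>i\<close> to \<open>Suc i\<close>. Hence facet
  \<open>i\<close> is tight and all others are strict.\<close>

lemma facet_point:
  fixes s :: "nat list"
  assumes len: "length s = CARD('n::{finite,linorder})" and pos: "\<forall>m\<in>set s. 0 < m"
    and i: "i \<le> CARD('n)" and "c > 0"
  shows "\<exists>p :: real ^ 'n::{finite,linorder}. facet_normal s i \<bullet> p + c * facet_offset s i = 0 \<and>
    (\<forall>j\<in>{..CARD('n)} - {i}. facet_normal s j \<bullet> p + c * facet_offset s j > 0)"
proof -
  define y where "y j = c * real (if j \<le> i then j else j - 1) / real CARD('n)" for j
  define Y where "Y j = real (bordered s ! j) * y j" for j
  have "Y 0 = 0" "Y (Suc CARD('n)) = c"
    using i bordered_ends(2)[of s] len by (simp_all add: Y_def y_def)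
  then obtain p :: "real ^ 'n::{finite,linorder}"
    where p: "\<And>j. j \<le> Suc CARD('n) \<Longrightarrow> ext_coord c p j = Y j"
    using ext_coord_exists[of Y c] by metis
  have eq: "facet_normal s j \<bullet> p + c * facet_offset s j =
      real (bordered s ! j) * real (bordered s ! Suc j) * (y (Suc j) - y j) / real (gcd (bordered s ! j) (bordered s ! Suc j))"
    if "j \<le> CARD('n)" for j
    using facet_normal_inner[OF len that, of p c] that
    by (simp add: p Y_def algebra_simps)
  have "y (Suc j) - y j = (if j = i then 0 else c / real CARD('n))" for j
    by (auto simp: y_def field_simps of_nat_diff)
  moreover note \<open>c > 0\<close>
  moreover have "0 < bordered s ! j" "0 < bordered s ! Suc j" if "j \<le> CARD('n)" for j
    using bordered_pos[OF pos] that len by auto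
  ultimately show ?thesis
    using i by (intro exI[of _ p]) (auto simp: eq intro!: divide_pos_pos mult_pos_pos)
qed

lemma facet_one_iff:
  fixes x :: "real ^ 'n::{finite,linorder}"
  assumes "length s = CARD('n)" and "\<forall>m\<in>set s. 0 < m" and "i \<le> CARD('n)"
  shows "facet_normal s i \<bullet> x + c * facet_offset s i = 1 \<longleftrightarrow>
    real (bordered s ! i) * ext_coord c x (Suc i) - real (bordered s ! Suc i) * ext_coord c x i =
      real (gcd (bordered s ! i) (bordered s ! Suc i))"
proof -
  have "gcd (bordered s ! i) (bordered s ! Suc i) \<noteq> 0"
    using bordered_pos[OF assms(2), of i] assms by simp
  then show ?thesis
    unfolding facet_normal_inner[OF assms(1,3)] by (auto simp: divide_eq_1_iff)
qed

lemma facet_steps_iff: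
  fixes s :: "nat list"
  assumes len: "length s = CARD('n::{finite,linorder})" and pos: "\<forall>m\<in>set s. 0 < m"
  shows "(\<exists>W. facet_steps (bordered s) k W) \<longleftrightarrow>
    (\<exists>u :: real ^ 'n::{finite,linorder}. u \<in> int_points \<and>
      (\<forall>i\<le>CARD('n). facet_normal s i \<bullet> u + real k * facet_offset s i = 1))"
proof
  assume "\<exists>W. facet_steps (bordered s) k W"
  then obtain W where W: "W 0 = 0" "W (Suc CARD('n)) = int k"
    "\<And>i. i \<le> CARD('n) \<Longrightarrow> int (bordered s ! i) * W (Suc i) - int (bordered s ! Suc i) * W i =
      int (gcd (bordered s ! i) (bordered s ! Suc i))"
    using len by (auto simp: facet_steps_def bordered_def)
  obtain u :: "real ^ 'n::{finite,linorder}" where u: "u \<in> int_points"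
    "\<And>j. j \<le> Suc CARD('n) \<Longrightarrow> ext_coord (real k) u j = real_of_int (W j)"
    using ext_coord_exists[where 'n = 'n and Y = "\<lambda>j. real_of_int (W j)" and c = "real k"] W(1,2)
    by (metis Ints_of_int of_int_0 of_int_of_nat_eq)
  have "facet_normal s i \<bullet> u + real k * facet_offset s i = 1" if "i \<le> CARD('n)" for i
    using arg_cong[OF W(3)[OF that], of real_of_int] that
    by (simp add: facet_one_iff[OF len pos] u)
  with u(1) show "\<exists>u :: real ^ 'n::{finite,linorder}. u \<in> int_points \<and>
      (\<forall>i\<le>CARD('n). facet_normal s i \<bullet> u + real k * facet_offset s i = 1)" by blast
next
  assume "\<exists>u :: real ^ 'n::{finite,linorder}. u \<in> int_points \<and>
      (\<forall>i\<le>CARD('n). facet_normal s i \<bullet> u + real k * facet_offset s i = 1)"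
  then obtain u :: "real ^ 'n::{finite,linorder}" where u: "u \<in> int_points"
    "\<And>i. i \<le> CARD('n) \<Longrightarrow> real (bordered s ! i) * ext_coord (real k) u (Suc i) -
      real (bordered s ! Suc i) * ext_coord (real k) u i = real (gcd (bordered s ! i) (bordered s ! Suc i))"
    using facet_one_iff[OF len pos] by blast
  \<comment> \<open>The floor only changes the type: up to position \<open>Suc CARD('n)\<close> the
    values are already integers.\<close>
  define W where "W i = \<lfloor>ext_coord (real k) u i\<rfloor>" for i
  have W: "real_of_int (W i) = ext_coord (real k) u i" if "i \<le> Suc CARD('n)" for i
    using ext_coord_int[OF u(1) _ that, of "real k"] by (simp add: W_def)
  have "int (bordered s ! i) * W (Suc i) - int (bordered s ! Suc i) * W i =
      int (gcd (bordered s ! i) (bordered s ! Suc i))" if "i \<le> CARD('n)" for i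
  proof -
    have "real_of_int (int (bordered s ! i) * W (Suc i) - int (bordered s ! Suc i) * W i) =
        real_of_int (int (gcd (bordered s ! i) (bordered s ! Suc i)))"
      using u(2)[OF that] that by (simp add: W)
    then show ?thesis by (simp only: of_int_eq_iff)
  qed
  then have "facet_steps (bordered s) k W"
    using len by (auto simp: facet_steps_def bordered_def W_def ext_coord_simps)
  then show "\<exists>W. facet_steps (bordered s) k W" by blast
qed

text \<open>Reflexivity forces distance 1 by \<open>unimodular_reflexive_facets\<close>. Conversely,
  translating the dilation by \<open>- u\<close> moves every facet to level -1, as
  \<open>reflexive_halfspaces\<close> requires, and the identity matrix gives the
  equivalence.\<close>

lemma gorenstein_lecture_hall_iff:
  fixes s :: "nat list"
  assumes len: "length s = CARD('n::{finite,linorder})" and pos: "\<forall>m\<in>set s. 0 < m"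
  shows "gorenstein k (lecture_hall s :: (real ^ 'n::{finite,linorder}) set) \<longleftrightarrow>
    k > 0 \<and> (\<exists>W. facet_steps (bordered s) k W)"
proof (cases "k > 0")
  case k: True
  let ?P = "lecture_hall s :: (real ^ 'n::{finite,linorder}) set"
  define R where "R = (\<lambda>x. real k *\<^sub>R x) ` ?P"
  have R: "R = {x. \<forall>i\<in>{..CARD('n)}. facet_normal s i \<bullet> x + real k * facet_offset s i \<ge> 0}"
    unfolding R_def using lecture_hall_scaled[OF len pos] k by simp
  show ?thesis
  proof
    assume "gorenstein k ?P"
    then obtain Q where "reflexive Q" "unimodularly_equivalent R Q"
      by (auto simp: gorenstein_def R_def)
    then have "\<exists>u\<in>int_points. \<forall>i\<in>{..CARD('n)}.
        (facet_normal s i :: real ^ 'n::{finite,linorder}) \<bullet> u + real k * facet_offset s i = 1"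
    proof (rule unimodular_reflexive_facets[OF R, rotated -2])
      fix i assume "i \<in> {..CARD('n)}"
      then have i: "i \<le> CARD('n)" by simp
      show "\<exists>z\<in>int_points. (facet_normal s i :: real ^ 'n::{finite,linorder}) \<bullet> z = 1"
        by (rule facet_normal_primitive[OF len pos i])
      show "\<exists>p :: real ^ 'n::{finite,linorder}. facet_normal s i \<bullet> p + real k * facet_offset s i = 0 \<and>
          (\<forall>j\<in>{..CARD('n)} - {i}. facet_normal s j \<bullet> p + real k * facet_offset s j > 0)"
        using k by (intro facet_point[OF len pos i]) simp
    qed (auto simp: facet_normal_int facet_offset_def)
    then show "k > 0 \<and> (\<exists>W. facet_steps (bordered s) k W)"
      using k by (auto simp: facet_steps_iff[OF len pos])
  next
    assume "k > 0 \<and> (\<exists>W. facet_steps (bordered s) k W)"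
    then obtain u :: "real ^ 'n::{finite,linorder}" where u: "u \<in> int_points"
      "\<And>i. i \<le> CARD('n) \<Longrightarrow> facet_normal s i \<bullet> u + real k * facet_offset s i = 1"
      by (auto simp: facet_steps_iff[OF len pos])
    define Q where "Q = (\<lambda>x. real k *\<^sub>R x + - u) ` ?P"
    have QR: "Q = (\<lambda>x. x + - u) ` R"
      by (simp add: Q_def R_def image_image)
    have Q: "Q = {x. \<forall>i\<in>{..CARD('n)}. facet_normal s i \<bullet> x \<ge> - 1}"
    proof -
      have "x \<in> Q \<longleftrightarrow> x + u \<in> R" for x
        by (auto simp: QR intro!: image_eqI[of _ _ "x + u"])
      moreover have "facet_normal s i \<bullet> (x + u) + real k * facet_offset s i \<ge> 0 \<longleftrightarrow>
          facet_normal s i \<bullet> x \<ge> - 1" if "i \<in> {..CARD('n)}" for i x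
        using u(2)[of i] that by (auto simp: inner_add_right)
      ultimately show ?thesis unfolding R by blast
    qed
    have mu: "- u \<in> int_points" using u(1) by (simp add: int_points_def)
    have lat: "lattice_polytope ?P" by (rule lattice_polytope_lecture_hall[OF len pos])
    have "lattice_polytope Q"
      unfolding Q_def by (rule lattice_polytope_affine_image[OF lat mu])
    then have refl: "reflexive Q"
      by (intro reflexive_halfspaces[OF Q]) (auto simp: facet_normal_int)
    moreover have "unimodularly_equivalent R Q"
      unfolding unimodularly_equivalent_def
    proof (intro exI conjI)
      show "det (mat 1 :: int ^ 'n::{finite,linorder} ^ 'n::{finite,linorder}) \<in> {1, - 1}" by simp
      have "map_matrix real_of_int (mat 1) = (mat 1 :: real ^ 'n::{finite,linorder} ^ 'n::{finite,linorder})"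
        by (simp add: map_matrix_def mat_def vec_eq_iff)
      then show "Q = (\<lambda>v. v v* map_matrix real_of_int (mat 1) + - u) ` R"
        by (simp add: QR)
    qed (rule mu)
    \<comment> \<open>Full dimension is read off the reflexive polytope, as translation and nonzero
      dilation preserve affine dimension.\<close>
    moreover have "aff_dim ?P = int CARD('n)"
    proof -
      have "aff_dim Q = int CARD('n)"
        using refl by (simp add: reflexive_def fano_def full_lattice_polytope_def)
      moreover have "Q = (+) (- u) ` R" by (auto simp: QR)
      ultimately have "aff_dim R = int CARD('n)" by (simp only: aff_dim_translation_eq)
      moreover have "aff_dim R = aff_dim ?P"
        unfolding R_def using k
        by (intro aff_dim_injective_linear_image)
          (auto simp: inj_on_def intro: linear_compose_scale_right linear_id linear_scaleR)
      ultimately show ?thesis by simp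
    qed
    ultimately show "gorenstein k ?P"
      using k lat unfolding gorenstein_def full_lattice_polytope_def R_def by blast
  qed
qed (simp add: gorenstein_def)

section \<open>Concatenating two integer chains at the shared entry 1\<close>

lemma facet_steps_join:
  assumes V: "facet_steps (bordered s) k V" and W: "facet_steps (bordered t) l W"
  shows "\<exists>X. facet_steps (bordered (s @ [1] @ t)) (k + l) X"
proof -
  let ?m = "Suc (length s)"
  define a where "a = bordered (s @ [1] @ t)"
  \<comment> \<open>Position \<open>?m\<close> holds the middle 1, the last entry of
    \<open>bordered s\<close> and the first of \<open>bordered t\<close>. Both branches give
    \<open>k\<close> there, since \<open>V ?m = k\<close> and \<open>W 0 = 0\<close>.\<close>
  define X where "X i = (if i \<le> ?m then V i else int k * int (bordered t ! (i - ?m)) + W (i - ?m))" for i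
  have left: "a ! i = bordered s ! i" if "i \<le> ?m" for i
    using that by (cases i) (auto simp: a_def bordered_def nth_append le_Suc_eq)
  have right: "a ! (?m + j) = bordered t ! j" for j
    by (simp add: a_def bordered_def nth_append)
  have V': "V 0 = 0" "V ?m = int k"
    "\<And>i. i < ?m \<Longrightarrow> int (bordered s ! i) * V (Suc i) - int (bordered s ! Suc i) * V i =
      int (gcd (bordered s ! i) (bordered s ! Suc i))"
    using V by (simp_all add: facet_steps_def bordered_def)
  have W': "W 0 = 0" "W (Suc (length t)) = int l"
    "\<And>i. i < Suc (length t) \<Longrightarrow> int (bordered t ! i) * W (Suc i) - int (bordered t ! Suc i) * W i =
      int (gcd (bordered t ! i) (bordered t ! Suc i))"
    using W by (simp_all add: facet_steps_def bordered_def)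
  have Xr: "X (?m + j) = int k * int (bordered t ! j) + W j" for j
    using V'(2) W'(1) bordered_ends(1)[of t] by (cases j) (simp_all add: X_def)
  have "int (a ! i) * X (Suc i) - int (a ! Suc i) * X i = int (gcd (a ! i) (a ! Suc i))"
    if "i < ?m + Suc (length t)" for i
  proof (cases "i < ?m")
    case True
    then show ?thesis using V'(3)[OF True] by (simp add: left X_def)
  next
    case False
    then obtain j where i: "i = ?m + j" by (metis not_less le_iff_add)
    then have "j < Suc (length t)" using that by simp
    then have "int (bordered t ! j) * W (Suc j) - int (bordered t ! Suc j) * W j =
        int (gcd (bordered t ! j) (bordered t ! Suc j))"
      by (rule W'(3))
    moreover have "a ! i = bordered t ! j" "a ! Suc i = bordered t ! Suc j"
      using right[of j] right[of "Suc j"] i by simp_all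
    moreover have "X i = int k * int (bordered t ! j) + W j"
      "X (Suc i) = int k * int (bordered t ! Suc j) + W (Suc j)"
      using Xr[of j] Xr[of "Suc j"] i by simp_all
    \<comment> \<open>The added multiple of \<open>bordered t\<close> cancels in the cross
      difference, so the equation for \<open>W\<close> carries over.\<close>
    ultimately show ?thesis by (simp add: algebra_simps)
  qed
  moreover have "X 0 = 0" using V'(1) by (simp add: X_def)
  moreover have "X (?m + Suc (length t)) = int (k + l)"
    unfolding Xr using W'(2) bordered_ends(2)[of t] by simp
  moreover have "length a - 1 = ?m + Suc (length t)" by (simp add: a_def bordered_def)
  ultimately have "facet_steps a (k + l) X"
    unfolding facet_steps_def by simp
  then show ?thesis unfolding a_def by blast
qed

theorem theorem4p3:
  fixes s t :: "nat list" and k l :: nat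
  assumes "length s = CARD('d::{finite,linorder})" and "\<forall>m\<in>set s. 0 < m"
    and "length t = CARD('e::{finite,linorder})" and "\<forall>m\<in>set t. 0 < m"
    and "CARD('f::{finite,linorder}) = CARD('d::{finite,linorder}) + CARD('e::{finite,linorder}) + 1"
    and "gorenstein k (lecture_hall s :: (real ^ 'd::{finite,linorder}) set)"
    and "gorenstein l (lecture_hall t :: (real ^ 'e::{finite,linorder}) set)"
  shows "gorenstein (k + l) (lecture_hall (s @ [1] @ t) :: (real ^ 'f::{finite,linorder}) set)"
proof -
  have "length (s @ [1] @ t) = CARD('f)" "\<forall>m\<in>set (s @ [1] @ t). 0 < m"
    using assms(1-5) by auto
  note iff = gorenstein_lecture_hall_iff[OF this]
  show ?thesis
    using assms(6,7) facet_steps_join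
    unfolding iff gorenstein_lecture_hall_iff[OF assms(1,2)] gorenstein_lecture_hall_iff[OF assms(3,4)]
    by blast
qed

end
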